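(* Let $\{P_n(x)\}_{n\ge0}$ be an Appell sequence of polynomials over $\mathbb C$, so that $$P_n(x+y)=\sum_{k=0}^n\binom nkP_k(x)y^{n-k}\qquad(n\ge0),$$ and assume that for some constant $c\in\mathbb C$, $$P_n(c-x)=(-1)^nP_n(x)\qquad(n\ge0).$$ For $\alpha,x\in\mathbb C$ define $$\mathcal P_{\alpha,x}(z):=\sum_{k\ge0}\binom{\alpha}{k}P_k(x)z^k\in\mathbb C[[z]].$$ Then for all $\alpha, x\in\mathbb C$, $$\mathcal P_{\alpha,x}\!\left(-\frac{z}{1-z}\right)=(1-z)^{-\alpha}\,\mathcal P_{\alpha,c-1-x}(z).$$ Consequently, for every integer $r\ge0$ and every $h\in\mathbb C[[z]]$, $$[z^r]\,h(z)\mathcal P_{\alpha,x}(z)=[z^r]\,h\!\left(\frac{z}{1+z}\right)(1+z)^{r-1-\alpha}\,\mathcal P_{\alpha,c-1-x}(-z).$$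
   Context: $[z^r]H(z)$ denotes the coefficient of $z^r$ in the formal power series $H(z)$. For $\beta\in\mathbb C$, $\binom{\beta}{k}=\beta(\beta-1)\cdots(\beta-k+1)/k!$ and $(1\pm z)^\beta:=\sum_{k\ge0}\binom{\beta}{k}(\pm z)^k$. All identities are between formal power series. *)

theory Defs
  imports Complex_Main
    "HOL-Computational_Algebra.Polynomial"
    "HOL-Computational_Algebra.Formal_Power_Series"
begin

text \<open>No condition on \<^term>\<open>P 0\<close> is imposed: the addition formula forces \<^term>\<open>P 0\<close> to be
  constant, and the convention \<open>degree (P n) = n\<close> is the special case \<open>P 0 \<noteq> 0\<close>.\<close>

definition appell_sequence :: "(nat \<Rightarrow> complex poly) \<Rightarrow> bool" where
  "appell_sequence P \<longleftrightarrow>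
     (\<forall>n x y. poly (P n) (x + y) =
        (\<Sum>k\<le>n. of_nat (n choose k) * poly (P k) x * y ^ (n - k)))"

definition appell_series :: "(nat \<Rightarrow> complex poly) \<Rightarrow> complex \<Rightarrow> complex \<Rightarrow> complex fps" where
  "appell_series P \<alpha> x = Abs_fps (\<lambda>k. (\<alpha> gchoose k) * poly (P k) x)"

text \<open>The power \<open>(1 + z)\<^sup>\<beta>\<close> is the library's \<^term>\<open>fps_binomial \<beta>\<close>, whose \<open>k\<close>-th coefficient is
  \<^term>\<open>\<beta> gchoose k\<close>; the power \<open>(1 - z)\<^sup>\<beta>\<close> is \<^term>\<open>fps_binomial \<beta> oo (- fps_X)\<close>.
  Every inner series substituted below has constant term \<open>0\<close>, and the denominators
  \<open>1 - z\<close>, \<open>1 + z\<close> are units, so \<open>oo\<close> and \<open>/\<close> have their usual meaning.\<close>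

end

theory Submission
  imports Defs
begin

text \<open>The Appell property and the symmetry give
  \<open>(-1)\<^sup>k P\<^sub>k(x) = P\<^sub>k(y + 1) = (\<Sum>j\<le>k. (k choose j) P\<^sub>j(y))\<close> with \<open>y = c - 1 - x\<close>, and for each \<open>j\<close> the
  series \<open>\<Sum>k. (\<alpha> gchoose k) (k choose j) (-z)\<^sup>k = (\<alpha> gchoose j) (-z)\<^sup>j (1 - z)\<^bsup>\<alpha>-j\<^esup>\<close> becomes
  \<open>(\<alpha> gchoose j) (-z)\<^sup>j (1 + z)\<^bsup>-\<alpha>\<^esup>\<close> under \<open>z \<mapsto> z / (1 + z)\<close>. The
  coefficient identity follows from
  \<open>[z\<^sup>r] f(z) = [z\<^sup>r] f(z / (1 + z)) (1 + z)\<^bsup>r-1\<^esup>\<close>, which is checked on monomials.\<close>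

unbundle fps_syntax

text \<open>In this product form, powers of the substituted series and their products with other
  powers of 1 + z merge by adding exponents.\<close>

lemma fps_X_over_one_plus_X:
  "fps_X / (1 + fps_X) = (fps_X * fps_binomial (-1) :: 'a::field_char_0 fps)"
  by (simp add: fps_binomial_minus_one fps_divide_unit)

lemma fps_X_binomial_power:
  "(fps_X * fps_binomial (-1) :: 'a::field_char_0 fps) ^ k = fps_X ^ k * fps_binomial (- of_nat k)"
  by (simp add: power_mult_distrib fps_binomial_power)

text \<open>Since 1 - z / (1 + z) = 1 / (1 + z), the composite F should be a power of 1 + z. As the
  exponent is an arbitrary scalar, this is proved through the differential equation F' = -\<beta> F
  / (1 + z).\<close>

lemma fps_binomial_compose_neg_X_over_one_plus_X:
  "fps_binomial \<beta> oo (- (fps_X * fps_binomial (-1))) = (fps_binomial (- \<beta>) :: 'a::field_char_0 fps)"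
proof -
  define I :: "'a fps" where "I = inverse (1 + fps_X)"
  have I: "(1 + fps_X) * I = 1"
    unfolding I_def by (subst mult.commute, rule inverse_mult_eq_1) simp
  define g :: "'a fps" where "g = - (fps_X * I)"
  have g0: "g $ 0 = 0" by (simp add: g_def)
  have g1: "1 + g = I"
    using I by (simp add: g_def algebra_simps)
  have dI: "fps_deriv I = - (I * I)"
    unfolding I_def by (subst fps_inverse_deriv) (simp_all add: power2_eq_square)
  have dg: "fps_deriv g = - (I * I)"
  proof -
    have "fps_deriv g = fps_deriv (1 + g)" by simp
    then show ?thesis using g1 dI by simp
  qed
  \<comment> \<open>The denominator is cleared so that composition with \<open>g\<close>, which
    sends 1 + z to \<open>I\<close>, respects the products.\<close>
  have *: "(1 + fps_X) * fps_deriv (fps_binomial \<beta>) = fps_const \<beta> * (fps_binomial \<beta> :: 'a fps)"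
    unfolding fps_binomial_deriv
    by (simp add: fps_divide_unit) (metis I I_def mult.left_commute mult.right_neutral)
  define D where "D = fps_deriv (fps_binomial \<beta>) oo g"
  define F where "F = fps_binomial \<beta> oo g"
  have ID: "I * D = fps_const \<beta> * F"
    using arg_cong[OF *, of "\<lambda>f. f oo g"] g0 g1
    by (simp add: fps_compose_mult_distrib fps_compose_add_distrib D_def F_def)
  have "fps_deriv F = D * fps_deriv g"
    unfolding F_def D_def by (rule fps_compose_deriv[OF g0])
  \<comment> \<open>One of the two factors \<open>I\<close> in \<open>dg\<close> is absorbed by
    \<open>ID\<close>; the other is the division by 1 + z.\<close>
  also have "\<dots> = fps_const (- \<beta>) * F / (1 + fps_X)"
    using arg_cong[OF ID, of "\<lambda>f. f * I"]
    by (simp add: dg fps_divide_unit I_def[symmetric] mult_ac flip: fps_const_neg)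
  finally have "F = fps_const (F $ 0) * fps_binomial (- \<beta>)"
    by (subst fps_binomial_ODE_unique[symmetric])
  then show ?thesis
    by (simp add: F_def g_def I_def fps_binomial_minus_one)
qed

lemma fps_nth_compose_X_over_one_plus_X:
  fixes f :: "'a::field_char_0 fps"
  shows "fps_nth ((f oo (fps_X * fps_binomial (-1))) * fps_binomial (of_nat r - 1)) r = fps_nth f r"
proof -
  let ?v = "fps_X * fps_binomial (-1) :: 'a fps"
  have mono: "fps_nth (?v ^ k * fps_binomial (of_nat r - 1)) r = (if k = r then 1 else 0)"
    if "k \<le> r" for k
  proof -
    have "?v ^ k * fps_binomial (of_nat r - 1) = fps_X ^ k * fps_binomial (of_nat (r - k) - 1)"
    proof -
      have "- of_nat k + (of_nat r - 1) = (of_nat (r - k) - 1 :: 'a)"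
        using that by (simp add: of_nat_diff)
      then show ?thesis
        by (simp only: fps_X_binomial_power mult.assoc flip: fps_binomial_add_mult)
    qed
    then have "fps_nth (?v ^ k * fps_binomial (of_nat r - 1)) r =
        (of_nat (r - k) - 1) gchoose (r - k)"
      using that by (simp add: fps_X_power_mult_nth)
    \<comment> \<open>For k < r the upper index is the natural number r - k - 1, one below the lower
      index, so the binomial vanishes; for k = r it is -1 over 0, which is 1.\<close>
    also have "\<dots> = (if k = r then 1 else 0)"
    proof (cases "r - k")
      case (Suc m)
      have "(of_nat m :: 'a) gchoose (Suc m) = of_nat (m choose Suc m)"
        by (simp only: binomial_gbinomial)
      then show ?thesis using Suc that by auto
    qed (use that in auto)
    finally show ?thesis .
  qed
  have v0: "?v $ 0 = 0" by simp
  \<comment> \<open>The powers \<open>?v ^ k\<close> with k > i do not reach degree i, so the bound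
    can be r for every i, and the sums can be swapped.\<close>
  have trunc: "fps_nth (f oo ?v) i = (\<Sum>k\<le>r. f $ k * (?v ^ k) $ i)" if "i \<le> r" for i
    unfolding fps_compose_nth
    by (rule sum.mono_neutral_left)
      (use that in \<open>auto simp: startsby_zero_power_prefix[OF v0]\<close>)
  have "fps_nth ((f oo ?v) * fps_binomial (of_nat r - 1)) r =
      (\<Sum>i\<le>r. (\<Sum>k\<le>r. f $ k * (?v ^ k) $ i) * fps_binomial (of_nat r - 1) $ (r - i))"
    by (simp add: fps_mult_nth trunc atMost_atLeast0)
  also have "\<dots> = (\<Sum>k\<le>r. f $ k * fps_nth (?v ^ k * fps_binomial (of_nat r - 1)) r)"
    unfolding fps_mult_nth sum_distrib_left sum_distrib_right
    by (subst sum.swap) (simp add: atMost_atLeast0 mult.assoc)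
  also have "\<dots> = (\<Sum>k\<le>r. if k = r then f $ k else 0)"
    by (intro sum.cong) (auto simp: mono)
  finally show ?thesis by simp
qed

lemma gbinomial_mult_binomial_revision:
  fixes \<alpha> :: "'a::field_char_0"
  assumes "j \<le> k"
  shows "(\<alpha> gchoose k) * of_nat (k choose j) = (\<alpha> gchoose j) * ((\<alpha> - of_nat j) gchoose (k - j))"
  using gbinomial_trinomial_revision[OF assms, of \<alpha>] by (simp add: binomial_gbinomial)

text \<open>Trinomial revision pulls out the factor \<open>\<alpha> gchoose j\<close>; the sign
  splits as (-1)^j (-1)^(k - j), and terms with k < j vanish.\<close>

lemma fps_gbinomial_mult_binomial:
  fixes \<alpha> :: "'a::field_char_0"
  shows "Abs_fps (\<lambda>k. (- 1) ^ k * ((\<alpha> gchoose k) * of_nat (k choose j))) =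
    fps_const (\<alpha> gchoose j) * (- fps_X) ^ j * (fps_binomial (\<alpha> - of_nat j) oo (- fps_X))"
    (is "?l = ?r")
proof (rule fps_ext)
  fix k
  have *: "(- fps_X) ^ j = fps_const ((-1) ^ j) * (fps_X ^ j :: 'a fps)"
    by (metis fps_const_neg fps_const_1_eq_1 fps_const_power mult_minus1 power_mult_distrib)
  show "?l $ k = ?r $ k"
  proof (cases "j \<le> k")
    case True
    then have "(-1) ^ j * (-1) ^ (k - j) = ((-1) ^ k :: 'a)"
      by (simp flip: power_add)
    with True show ?thesis
      by (simp add: * fps_compose_uminus' fps_X_power_mult_nth mult.assoc
          gbinomial_mult_binomial_revision)
  next
    case False
    then show ?thesis
      by (simp add: * fps_X_power_mult_nth mult.assoc binomial_eq_0)
  qed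
qed

text \<open>The exponent -j from the j-th power of the substituted series cancels the j in j -
  \<alpha>. The remaining power of 1 + z does not depend on j, so it factors out of the later sum
  over j.\<close>

lemma fps_gbinomial_mult_binomial_compose:
  fixes \<alpha> :: "'a::field_char_0"
  shows "Abs_fps (\<lambda>k. (- 1) ^ k * ((\<alpha> gchoose k) * of_nat (k choose j)))
      oo (fps_X * fps_binomial (-1)) =
    fps_const (\<alpha> gchoose j) * (- fps_X) ^ j * fps_binomial (- \<alpha>)"
proof -
  let ?v = "fps_X * fps_binomial (-1) :: 'a fps"
  have X: "(- fps_X) oo ?v = - ?v" by (simp add: fps_compose_uminus)
  have "(fps_binomial (\<alpha> - of_nat j) oo (- fps_X)) oo ?v = fps_binomial (\<alpha> - of_nat j) oo (- ?v)"
    by (subst fps_compose_assoc[symmetric]) (simp_all add: X)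
  also have "\<dots> = fps_binomial (of_nat j - \<alpha>)"
    by (simp add: fps_binomial_compose_neg_X_over_one_plus_X)
  finally have B: "(fps_binomial (\<alpha> - of_nat j) oo (- fps_X)) oo ?v = fps_binomial (of_nat j - \<alpha>)" .
  have "(- fps_X) ^ j oo ?v = (- ?v) ^ j"
    by (simp add: X flip: fps_compose_power)
  also have "\<dots> = (- fps_X) ^ j * fps_binomial (- of_nat j)"
    by (metis fps_binomial_power mult_minus_left mult_minus1_right power_mult_distrib)
  finally have P: "(- fps_X) ^ j oo ?v = (- fps_X) ^ j * fps_binomial (- of_nat j)" .
  have E: "fps_binomial (- of_nat j) * fps_binomial (of_nat j - \<alpha>) = fps_binomial (- \<alpha>)"
    by (simp flip: fps_binomial_add_mult)
  show ?thesis
    unfolding fps_gbinomial_mult_binomial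
    by (simp add: fps_compose_mult_distrib B P mult.assoc E)
qed

lemma appell_series_compose:
  assumes "appell_sequence P"
    and "\<And>n x. poly (P n) (c - x) = (- 1) ^ n * poly (P n) x"
  shows "appell_series P \<alpha> x oo (fps_X * fps_binomial (-1)) =
    fps_binomial (- \<alpha>) * (appell_series P \<alpha> (c - 1 - x) oo (- fps_X))"
proof (rule fps_ext)
  fix n
  let ?v = "fps_X * fps_binomial (-1) :: complex fps"
  define y where "y = c - 1 - x"
  \<comment> \<open>Here x = c - (y + 1), and the addition formula is used with increment 1.\<close>
  have P: "poly (P k) x = (\<Sum>j\<le>k. (- 1) ^ k * of_nat (k choose j) * poly (P j) y)" for k
  proof -
    have "poly (P k) x = (- 1) ^ k * poly (P k) (y + 1)"
      using assms(2)[of k "y + 1"] by (simp add: y_def)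
    also have "poly (P k) (y + 1) = (\<Sum>j\<le>k. of_nat (k choose j) * poly (P j) y)"
      using assms(1) unfolding appell_sequence_def by simp
    finally show ?thesis by (simp add: sum_distrib_left mult.assoc)
  qed
  \<comment> \<open>Padding with zero binomials gives a bound independent of k, ready for exchanging
    the sums over j and k.\<close>
  have P': "poly (P k) x = (\<Sum>j\<le>n. (- 1) ^ k * of_nat (k choose j) * poly (P j) y)" if "k \<le> n" for k
    unfolding P by (rule sum.mono_neutral_left) (use that in \<open>auto simp: binomial_eq_0\<close>)
  let ?A = "\<lambda>j. Abs_fps (\<lambda>k. (- 1) ^ k * ((\<alpha> gchoose k) * of_nat (k choose j)))"
  have "fps_nth (appell_series P \<alpha> x oo ?v) n =
      (\<Sum>k\<le>n. \<Sum>j\<le>n. poly (P j) y * (?A j $ k * (?v ^ k) $ n))"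
    unfolding fps_compose_nth atMost_atLeast0[symmetric] appell_series_def
    by (intro sum.cong refl) (simp add: P' sum_distrib_left sum_distrib_right mult_ac)
  also have "\<dots> = (\<Sum>j\<le>n. poly (P j) y * fps_nth (?A j oo ?v) n)"
    unfolding fps_compose_nth atMost_atLeast0[symmetric] sum_distrib_left by (rule sum.swap)
  also have "\<dots> = (\<Sum>j\<le>n. (- 1) ^ j * (\<alpha> gchoose j) * poly (P j) y * fps_binomial (- \<alpha>) $ (n - j))"
  proof (intro sum.cong refl)
    fix j assume j: "j \<in> {..n}"
    have "(- fps_X) ^ j = fps_const ((-1) ^ j) * (fps_X ^ j :: complex fps)"
      by (metis fps_const_neg fps_const_1_eq_1 fps_const_power mult_minus1 power_mult_distrib)
    then show "poly (P j) y * fps_nth (?A j oo ?v) n =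
        (- 1) ^ j * (\<alpha> gchoose j) * poly (P j) y * fps_binomial (- \<alpha>) $ (n - j)"
      using j unfolding fps_gbinomial_mult_binomial_compose
      by (simp add: fps_X_power_mult_nth mult.assoc)
  qed
  also have "\<dots> = fps_nth (fps_binomial (- \<alpha>) * (appell_series P \<alpha> y oo (- fps_X))) n"
    unfolding mult.commute[of "fps_binomial (- \<alpha>)"]
    by (simp add: fps_mult_nth appell_series_def fps_compose_uminus' atMost_atLeast0 mult.assoc)
  finally show "fps_nth (appell_series P \<alpha> x oo ?v) n =
      fps_nth (fps_binomial (- \<alpha>) * (appell_series P \<alpha> (c - 1 - x) oo (- fps_X))) n"
    unfolding y_def .
qed

theorem theorem5p1:
  fixes P :: "nat \<Rightarrow> complex poly" and c :: complex
  assumes "appell_sequence P"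
    and "\<And>n x. poly (P n) (c - x) = (- 1) ^ n * poly (P n) x"
  shows "\<forall>\<alpha> x.
      appell_series P \<alpha> x oo (- (fps_X / (1 - fps_X))) =
        (fps_binomial (- \<alpha>) oo (- fps_X)) * appell_series P \<alpha> (c - 1 - x) \<and>
      (\<forall>(r::nat) (h::complex fps).
        fps_nth (h * appell_series P \<alpha> x) r =
        fps_nth ((h oo (fps_X / (1 + fps_X))) * fps_binomial (of_nat r - 1 - \<alpha>) *
                 (appell_series P \<alpha> (c - 1 - x) oo (- fps_X))) r)"
proof (intro allI conjI)
  fix \<alpha> x :: complex
  let ?v = "fps_X * fps_binomial (-1) :: complex fps"
  let ?A = "appell_series P \<alpha> x" and ?B = "appell_series P \<alpha> (c - 1 - x)"
  have AB: "?A oo ?v = fps_binomial (- \<alpha>) * (?B oo (- fps_X))"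
    using assms by (rule appell_series_compose)
  have X: "(- fps_X) oo (- fps_X) = (fps_X :: complex fps)"
    by (simp add: fps_compose_uminus)
  \<comment> \<open>Substituting -z turns \<open>AB\<close> into the first claim, as z -> -z is an
    involution. In the division rule, the composed denominator 1 - z is seen to be nonzero at its
    constant term.\<close>
  have v: "?v oo (- fps_X) = - (fps_X / (1 - fps_X))"
  proof -
    have "?v oo (- fps_X) = (fps_X oo (- fps_X)) / ((1 + fps_X) oo (- fps_X))"
      unfolding fps_X_over_one_plus_X[symmetric]
      by (rule fps_compose_divide_distrib)
        (simp_all add: fps_compose_add_distrib fps_eq_iff exI[of _ 0])
    then show ?thesis
      by (simp add: fps_compose_add_distrib fps_divide_unit)
  qed
  have "?A oo (- (fps_X / (1 - fps_X))) = (?A oo ?v) oo (- fps_X)"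
    by (simp add: fps_compose_assoc flip: v)
  also have "\<dots> = (fps_binomial (- \<alpha>) oo (- fps_X)) * (?B oo (- fps_X) oo (- fps_X))"
    unfolding AB by (rule fps_compose_mult_distrib) simp
  also have "?B oo (- fps_X) oo (- fps_X) = ?B"
    by (subst fps_compose_assoc[symmetric]) (simp_all add: X)
  finally show "?A oo (- (fps_X / (1 - fps_X))) = (fps_binomial (- \<alpha>) oo (- fps_X)) * ?B" .
  fix r :: nat and h :: "complex fps"
  \<comment> \<open>The coefficient identity is applied to the whole product; \<open>AB\<close> then
    supplies the exponent -\<alpha>, which joins r - 1.\<close>
  have "fps_nth (h * ?A) r =
      fps_nth (((h * ?A) oo ?v) * fps_binomial (of_nat r - 1)) r"
    by (simp only: fps_nth_compose_X_over_one_plus_X)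
  also have "((h * ?A) oo ?v) * fps_binomial (of_nat r - 1) =
      (h oo ?v) * (fps_binomial (of_nat r - 1) * fps_binomial (- \<alpha>)) * (?B oo (- fps_X))"
    by (simp add: fps_compose_mult_distrib AB mult_ac)
  also have "fps_binomial (of_nat r - 1) * fps_binomial (- \<alpha>) = fps_binomial (of_nat r - 1 - \<alpha>)"
    by (simp flip: fps_binomial_add_mult)
  finally show "fps_nth (h * ?A) r =
      fps_nth ((h oo (fps_X / (1 + fps_X))) * fps_binomial (of_nat r - 1 - \<alpha>) *
        (?B oo (- fps_X))) r"
    by (simp only: fps_X_over_one_plus_X)
qed

end
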